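(* Let $k\ge 2$ and let $G_1,\dots,G_k$ be finite simple undirected graphs, where $G_m$ has $s_m$ vertices, $1\le m\le k$. Then $$Mo(G_1\,\square\, G_2\,\square\cdots\square\, G_k)=\sum_{i=1}^{k} Mo(G_i)\prod_{j=1,\,j\ne i}^{k} s_j^2 .$$
   Context: For a graph $X$ and an edge $e=uv$ of $X$, $n_u(e\mid X)$ denotes the number of vertices $w$ of $X$ with $d_X(w,u)<d_X(w,v)$ ($d_X$ the shortest-path distance). The Mostar index is $Mo(X)=\sum_{uv\in E(X)}|n_u(e\mid X)-n_v(e\mid X)|$. $G\,\square\, H$ denotes the Cartesian product: vertex set $V(G)\times V(H)$, with $(a,b)(a',b')$ an edge iff either $a=a'$ and $bb'\in E(H)$, or $aa'\in E(G)$ and $b=b'$.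
   Formalization: The graphs G_1,…,G_k are additionally assumed connected; without this the formula fails, e.g. for G_1 = P_3 and G_2 = two isolated vertices the left side is 4 and the right side is 8. *)

theory Defs
  imports "Graph_Theory.Pair_Digraph" "Graph_Theory.Shortest_Path"
begin

text \<open>
  A finite simple undirected graph is a \<^locale>\<open>pair_graph\<close>: every undirected edge \<open>uv\<close> is
  represented by the two arcs \<open>(u, v)\<close> and \<open>(v, u)\<close>.
\<close>

definition edge_set :: "'a pair_pre_digraph \<Rightarrow> 'a set set" where
  "edge_set X = {{u, v} | u v. (u, v) \<in> parcs X}"

text \<open>The value is \<open>\<infinity>\<close> if there is no path between the two vertices.\<close>

definition gdist :: "'a pair_pre_digraph \<Rightarrow> 'a \<Rightarrow> 'a \<Rightarrow> ereal" where
  "gdist X u v = wf_digraph.\<mu> (with_proj X) (\<lambda>_. 1) u v"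

text \<open>\<open>n_closer X u v\<close> is $n_u(e \mid X)$ for the edge $e = uv$.\<close>

definition n_closer :: "'a pair_pre_digraph \<Rightarrow> 'a \<Rightarrow> 'a \<Rightarrow> nat" where
  "n_closer X u v = card {w \<in> pverts X. gdist X w u < gdist X w v}"

text \<open>
  The summand of the Mostar index is symmetric in the two ends of the edge, so it is a
  function of the unordered edge; see \<open>edge_imbalance_doubleton\<close>.
\<close>

definition edge_imbalance :: "'a pair_pre_digraph \<Rightarrow> 'a set \<Rightarrow> int" where
  "edge_imbalance X e =
    (THE d. \<exists>u v. e = {u, v} \<and> d = \<bar>int (n_closer X u v) - int (n_closer X v u)\<bar>)"

lemma edge_imbalance_doubleton:
  "edge_imbalance X {u, v} = \<bar>int (n_closer X u v) - int (n_closer X v u)\<bar>"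
  unfolding edge_imbalance_def
  by (rule the_equality) (auto simp: doubleton_eq_iff abs_minus_commute)

definition Mostar :: "'a pair_pre_digraph \<Rightarrow> int" where
  "Mostar X = (\<Sum>e\<in>edge_set X. edge_imbalance X e)"

definition cart_prod ::
  "'a pair_pre_digraph \<Rightarrow> 'b pair_pre_digraph \<Rightarrow> ('a \<times> 'b) pair_pre_digraph"
  (infixl \<open>\<square>\<close> 70) where
  "G \<square> H = \<lparr> pverts = pverts G \<times> pverts H,
     parcs = {((a, b), (a', b')).
       (a = a' \<and> a \<in> pverts G \<and> (b, b') \<in> parcs H) \<or>
       ((a, a') \<in> parcs G \<and> b = b' \<and> b \<in> pverts H)} \<rparr>"

definition relabel :: "('a \<Rightarrow> 'b) \<Rightarrow> 'a pair_pre_digraph \<Rightarrow> 'b pair_pre_digraph" where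
  "relabel f G = \<lparr> pverts = f ` pverts G, parcs = map_prod f f ` parcs G \<rparr>"

text \<open>
  \<open>iter_prod G k\<close> is \<open>G 1 \<square> G 2 \<square> \<dots> \<square> G k\<close>, associated to the left. The type of the nested
  pairs would depend on \<open>k\<close>, so the vertex \<open>((x\<^sub>1, x\<^sub>2), \<dots>, x\<^sub>k)\<close> is written as the list
  \<open>[x\<^sub>1, \<dots>, x\<^sub>k]\<close>; the relabelling is injective. The empty product is the one-vertex
  graph, the unit of \<open>\<square>\<close>. See \<open>pverts_iter_prod\<close> and \<open>parcs_iter_prod\<close>.
\<close>

primrec iter_prod :: "(nat \<Rightarrow> 'a pair_pre_digraph) \<Rightarrow> nat \<Rightarrow> 'a list pair_pre_digraph" where
  "iter_prod G 0 = \<lparr> pverts = {[]}, parcs = {} \<rparr>"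
| "iter_prod G (Suc k) = relabel (\<lambda>(xs, x). xs @ [x]) (iter_prod G k \<square> G (Suc k))"

lemma pverts_iter_prod:
  "pverts (iter_prod G k) = {xs. length xs = k \<and> (\<forall>i<k. xs ! i \<in> pverts (G (Suc i)))}"
proof (induction k)
  case 0
  show ?case by simp
next
  case (Suc k)
  have "xs \<in> pverts (iter_prod G (Suc k)) \<longleftrightarrow>
      length xs = Suc k \<and> (\<forall>i<Suc k. xs ! i \<in> pverts (G (Suc i)))" for xs
    by (cases xs rule: rev_cases)
      (auto simp: relabel_def cart_prod_def Suc.IH image_iff nth_append less_Suc_eq)
  then show ?case by blast
qed

lemma parcs_iter_prod:
  "parcs (iter_prod G k) =
    {(xs, ys). xs \<in> pverts (iter_prod G k) \<and> ys \<in> pverts (iter_prod G k) \<and>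
      (\<exists>i<k. (xs ! i, ys ! i) \<in> parcs (G (Suc i)) \<and> (\<forall>j<k. j \<noteq> i \<longrightarrow> xs ! j = ys ! j))}"
  if "\<And>m. m \<in> {1..k} \<Longrightarrow> pair_wf_digraph (G m)"
  using that
proof (induction k)
  case 0
  show ?case by simp
next
  case (Suc k)
  have wf: "pair_wf_digraph (G (Suc k))" using Suc.prems by simp
  have IH: "(us, vs) \<in> parcs (iter_prod G k) \<longleftrightarrow>
     us \<in> pverts (iter_prod G k) \<and> vs \<in> pverts (iter_prod G k) \<and>
      (\<exists>i<k. (us ! i, vs ! i) \<in> parcs (G (Suc i)) \<and> (\<forall>j<k. j \<noteq> i \<longrightarrow> us ! j = vs ! j))"
    for us vs using Suc by auto
  have V: "us @ [x] \<in> pverts (iter_prod G (Suc k)) \<longleftrightarrow>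
      us \<in> pverts (iter_prod G k) \<and> x \<in> pverts (G (Suc k))" for us x
    by (auto simp: relabel_def cart_prod_def image_iff)
  have len: "us \<in> pverts (iter_prod G n) \<Longrightarrow> length us = n" for us n
    by (simp add: pverts_iter_prod)
  have A: "(us @ [x], vs @ [y]) \<in> parcs (iter_prod G (Suc k)) \<longleftrightarrow>
      (us = vs \<and> us \<in> pverts (iter_prod G k) \<and> (x, y) \<in> parcs (G (Suc k))) \<or>
      ((us, vs) \<in> parcs (iter_prod G k) \<and> x = y \<and> x \<in> pverts (G (Suc k)))" for us vs x y
    by (force simp: relabel_def cart_prod_def image_iff)
  have "(us @ [x], vs @ [y]) \<in> parcs (iter_prod G (Suc k)) \<longleftrightarrow>
      us @ [x] \<in> pverts (iter_prod G (Suc k)) \<and> vs @ [y] \<in> pverts (iter_prod G (Suc k)) \<and>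
      (\<exists>i<Suc k. ((us @ [x]) ! i, (vs @ [y]) ! i) \<in> parcs (G (Suc i)) \<and>
        (\<forall>j<Suc k. j \<noteq> i \<longrightarrow> (us @ [x]) ! j = (vs @ [y]) ! j))" for us vs x y
  proof (cases "us \<in> pverts (iter_prod G k) \<and> vs \<in> pverts (iter_prod G k)")
    case True
    then have l: "length us = k" "length vs = k" by (auto dest: len)
    have eq: "us = vs \<longleftrightarrow> (\<forall>j<k. us ! j = vs ! j)"
      using l by (auto intro: nth_equalityI)
    have "(\<exists>i<Suc k. ((us @ [x]) ! i, (vs @ [y]) ! i) \<in> parcs (G (Suc i)) \<and>
          (\<forall>j<Suc k. j \<noteq> i \<longrightarrow> (us @ [x]) ! j = (vs @ [y]) ! j)) \<longleftrightarrow>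
        ((x, y) \<in> parcs (G (Suc k)) \<and> us = vs) \<or>
        (x = y \<and> (\<exists>i<k. (us ! i, vs ! i) \<in> parcs (G (Suc i)) \<and>
          (\<forall>j<k. j \<noteq> i \<longrightarrow> us ! j = vs ! j)))"
      unfolding Ex_less_Suc All_less_Suc eq using l
      by (simp add: nth_append cong: conj_cong imp_cong) blast
    then show ?thesis
      unfolding A V IH using True
        pair_wf_digraph.in_arcsD1[OF wf] pair_wf_digraph.in_arcsD2[OF wf] by metis
  next
    case False
    then show ?thesis unfolding A V IH by auto
  qed
  moreover have "xs \<noteq> [] \<and> ys \<noteq> []" if "(xs, ys) \<in> parcs (iter_prod G (Suc k))" for xs ys
    using that by (auto simp: relabel_def)
  moreover have "xs \<noteq> []" if "xs \<in> pverts (iter_prod G (Suc k))" for xs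
    using that by (auto simp: relabel_def)
  ultimately have "(xs, ys) \<in> parcs (iter_prod G (Suc k)) \<longleftrightarrow>
      xs \<in> pverts (iter_prod G (Suc k)) \<and> ys \<in> pverts (iter_prod G (Suc k)) \<and>
      (\<exists>i<Suc k. (xs ! i, ys ! i) \<in> parcs (G (Suc i)) \<and>
        (\<forall>j<Suc k. j \<noteq> i \<longrightarrow> xs ! j = ys ! j))" for xs ys
    by (cases xs rule: rev_cases; cases ys rule: rev_cases) blast+
  then show ?case by auto
qed

end

theory Submission
  imports Defs
begin

text \<open>
  Distances in a Cartesian product of connected graphs add up coordinatewise, so for an edge that
  moves only one coordinate the contributions of the other coordinates cancel: the vertices
  closer to one of its ends are obtained from those of the factor by a free choice of the other
  coordinates. Each edge of a factor \<open>G\<close> thus occurs \<open>\<bar>V(H)\<bar>\<close> times in \<open>G \<square> H\<close>, each time with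
  its imbalance multiplied by \<open>\<bar>V(H)\<bar>\<close>. This gives the case of two factors; induct on their number.
\<close>

section \<open>Distances as least exponents of powers of the arc relation\<close>

text \<open>Trades walks, which are lists of arcs, for relation powers, which are easy to project to
  coordinates, concatenate and relabel. The condition on \<open>u\<close> matters for
  \<open>n = 0\<close>: the zeroth power is the identity on the whole type, but an empty walk exists
  only at a vertex.\<close>

lemma relpow_iff_awalk:
  assumes "pair_wf_digraph X" "u \<in> pverts X"
  shows "(u, v) \<in> parcs X ^^ n \<longleftrightarrow> (\<exists>p. pre_digraph.awalk (with_proj X) u p v \<and> length p = n)"
  using assms(2)
proof (induction n arbitrary: u)
  interpret pair_wf_digraph X by fact
  case 0
  then show ?case by (auto simp: awalk_Nil_iff)
next
  interpret pair_wf_digraph X by fact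
  case (Suc n)
  \<comment> \<open>\<open>relpow\<close> splits off the last arc and \<open>awalk\<close> the
    first, so the power is commuted before the induction hypothesis is applied at
    \<open>w\<close>.\<close>
  have "(u, v) \<in> parcs X ^^ Suc n \<longleftrightarrow> (\<exists>w. (u, w) \<in> parcs X \<and> (w, v) \<in> parcs X ^^ n)"
    unfolding relpow.simps relpow_commute[symmetric] by auto
  also have "\<dots> \<longleftrightarrow> (\<exists>w. (u, w) \<in> parcs X \<and> (\<exists>p. awalk w p v \<and> length p = n))"
    using Suc.IH in_arcsD2 by blast
  also have "\<dots> \<longleftrightarrow> (\<exists>w p. awalk u ((u, w) # p) v \<and> length p = n)"
    by (auto simp: awalk_Cons_iff)
  also have "\<dots> \<longleftrightarrow> (\<exists>p. awalk u p v \<and> length p = Suc n)" (is "?L \<longleftrightarrow> ?R")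
  proof
    show "?L \<Longrightarrow> ?R" by (metis length_Cons)
    show "?R \<Longrightarrow> ?L" by (auto simp: length_Suc_conv awalk_Cons_iff) blast
  qed
  finally show ?case .
qed

lemma gdist_eqI:
  assumes "pair_wf_digraph X" "u \<in> pverts X" "(u, v) \<in> parcs X ^^ n"
    and "\<And>m. (u, v) \<in> parcs X ^^ m \<Longrightarrow> n \<le> m"
  shows "gdist X u v = ereal (real n)"
proof -
  interpret pair_wf_digraph X by fact
  have cost: "awalk_cost (\<lambda>_. 1) p = length p" for p
    by (induction p) auto
  obtain p where "awalk u p v" "length p = n"
    using assms(3) relpow_iff_awalk[OF assms(1,2)] by blast
  moreover have "n \<le> length q" if "awalk u q v" for q
    using that assms(4) relpow_iff_awalk[OF assms(1,2)] by blast
  \<comment> \<open>\<open>\<mu>\<close> is an infimum of costs over all walks, and unit weights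
    make cost equal to length: every \<open>q\<close> respects the lower bound, and \<open>p\<close>
    attains it.\<close>
  ultimately show ?thesis
    unfolding gdist_def \<mu>_def cost by (intro antisym INF_greatest INF_lower2[of p]) auto
qed

text \<open>Connectedness, stated below as an inclusion of all vertex pairs in the closure of the
  arcs, enters distance computations here: a reachable pair has a least exponent, so its distance is
  a natural number and not \<infinity>.\<close>

lemma gdist_relpow_obtain:
  assumes "pair_wf_digraph X" "u \<in> pverts X" "(u, v) \<in> (parcs X)\<^sup>*"
  obtains n where "gdist X u v = ereal (real n)" "(u, v) \<in> parcs X ^^ n"
    "\<And>m. (u, v) \<in> parcs X ^^ m \<Longrightarrow> n \<le> m"
proof -
  define n where "n = (LEAST n. (u, v) \<in> parcs X ^^ n)"
  have "(u, v) \<in> parcs X ^^ n"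
    unfolding n_def using rtrancl_imp_relpow[OF assms(3)] by (auto intro: LeastI)
  moreover have "n \<le> m" if "(u, v) \<in> parcs X ^^ m" for m
    unfolding n_def using that by (rule Least_le)
  ultimately show ?thesis
    using that gdist_eqI[OF assms(1,2)] by blast
qed

section \<open>Simple graphs as finite, symmetric, irreflexive relations\<close>

lemma pair_graphI:
  assumes "finite (pverts X)"
    and "parcs X \<subseteq> pverts X \<times> pverts X"
    and "sym (parcs X)" and "irrefl (parcs X)"
  shows "pair_graph X"
proof
  show "finite (parcs X)" using assms(1,2) by (auto intro: finite_subset)
qed (use assms in \<open>auto simp: symmetric_def irrefl_def\<close>)

lemma sym_parcs: "pair_graph X \<Longrightarrow> sym (parcs X)"
  using pair_sym_digraph.pair_sym_arcs[of X]
  by (simp add: pair_graph_def pair_pseudo_graph_def symmetric_def)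

lemma irrefl_parcs: "pair_graph X \<Longrightarrow> irrefl (parcs X)"
  using pair_loopfree_digraph.pair_no_loops[of X]
  by (fastforce simp: pair_graph_def pair_digraph_def irrefl_def)

lemma pair_graph_wf: "pair_graph X \<Longrightarrow> pair_wf_digraph X"
  by (simp add: pair_graph_def pair_digraph_def pair_fin_digraph_def)

lemma parcs_subset: "pair_wf_digraph X \<Longrightarrow> parcs X \<subseteq> pverts X \<times> pverts X"
  using pair_wf_digraph.wellformed' by fastforce

lemma finite_pverts: "pair_graph X \<Longrightarrow> finite (pverts X)"
  by (simp add: pair_graph_def pair_digraph_def pair_fin_digraph.pair_finite_verts)

lemma finite_parcs: "pair_graph X \<Longrightarrow> finite (parcs X)"
  by (simp add: pair_graph_def pair_digraph_def pair_fin_digraph.pair_finite_arcs)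

section \<open>The Mostar index as a sum over arcs\<close>

text \<open>Ordered version of \<open>edge_imbalance\<close>: sums over arcs can be reindexed along
  explicit injections, without handling doubletons.\<close>

definition arc_imbalance :: "'a pair_pre_digraph \<Rightarrow> 'a \<times> 'a \<Rightarrow> int" where
  "arc_imbalance X = (\<lambda>(u, v). \<bar>int (n_closer X u v) - int (n_closer X v u)\<bar>)"

text \<open>Forgetting orientation maps arcs onto edges. Each fibre has exactly two arcs, opposite
  and distinct because there are no loops, and both carry the imbalance of the edge.\<close>

lemma double_Mostar:
  assumes "pair_graph X"
  shows "2 * Mostar X = sum (arc_imbalance X) (parcs X)"
proof -
  let ?e = "\<lambda>(u, v). {u, v}"
  have E: "edge_set X = ?e ` parcs X"
    by (auto simp: edge_set_def image_iff)
  have "sum (arc_imbalance X) (parcs X) =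
      (\<Sum>e\<in>edge_set X. sum (arc_imbalance X) {a \<in> parcs X. ?e a = e})"
    unfolding E by (intro sum.image_gen finite_parcs assms)
  also have "\<dots> = (\<Sum>e\<in>edge_set X. 2 * edge_imbalance X e)"
  proof (rule sum.cong[OF refl])
    fix e assume "e \<in> edge_set X"
    then obtain u v where e: "e = {u, v}" "(u, v) \<in> parcs X"
      by (auto simp: edge_set_def)
    then have "u \<noteq> v" "(v, u) \<in> parcs X"
      using irrefl_parcs[OF assms] sym_parcs[OF assms] by (auto simp: irrefl_def dest: symD)
    then have "{a \<in> parcs X. ?e a = e} = {(u, v), (v, u)}"
      using e by (auto simp: doubleton_eq_iff)
    then show "sum (arc_imbalance X) {a \<in> parcs X. ?e a = e} = 2 * edge_imbalance X e"
      using \<open>u \<noteq> v\<close> by (simp add: e arc_imbalance_def edge_imbalance_doubleton abs_minus_commute)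
  qed
  finally show ?thesis by (simp add: Mostar_def sum_distrib_left)
qed

section \<open>Walks and distances in a product of two graphs\<close>

lemma pverts_cart_prod [simp]: "pverts (G \<square> H) = pverts G \<times> pverts H"
  by (simp add: cart_prod_def)

lemma in_parcs_cart_prod [simp]:
  "((a, b), (a', b')) \<in> parcs (G \<square> H) \<longleftrightarrow>
    (a = a' \<and> a \<in> pverts G \<and> (b, b') \<in> parcs H) \<or>
    ((a, a') \<in> parcs G \<and> b = b' \<and> b \<in> pverts H)"
  by (simp add: cart_prod_def)

lemma pair_graph_cart_prod:
  assumes "pair_graph G" "pair_graph H"
  shows "pair_graph (G \<square> H)"
proof (rule pair_graphI)
  show "finite (pverts (G \<square> H))"
    using assms by (simp add: finite_pverts)
  show "parcs (G \<square> H) \<subseteq> pverts (G \<square> H) \<times> pverts (G \<square> H)"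
    using assms[THEN pair_graph_wf, THEN parcs_subset] by auto
  show "sym (parcs (G \<square> H))"
    using assms[THEN sym_parcs] by (auto simp: sym_def)
  show "irrefl (parcs (G \<square> H))"
    using assms[THEN irrefl_parcs] by (auto simp: irrefl_def)
qed

lemma relpow_cart_prod_fst:
  assumes "(a, a') \<in> parcs G ^^ i" "b \<in> pverts H"
  shows "((a, b), (a', b)) \<in> parcs (G \<square> H) ^^ i"
  using assms(1)
proof (induction i arbitrary: a')
  case (Suc i)
  then show ?case using assms(2) by (auto simp: relcomp_unfold intro!: exI[of _ "(_, b)"])
qed simp

lemma relpow_cart_prod_snd:
  assumes "(b, b') \<in> parcs H ^^ j" "a \<in> pverts G"
  shows "((a, b), (a, b')) \<in> parcs (G \<square> H) ^^ j"
  using assms(1)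
proof (induction j arbitrary: b')
  case (Suc j)
  then show ?case using assms(2) by (auto simp: relcomp_unfold intro!: exI[of _ "(a, _)"])
qed simp

text \<open>Every arc of the product steps in one factor and fixes the other coordinate. Sorting the
  arcs of a walk by factor yields a walk in each, which gives the lower bound for distances.\<close>

lemma relpow_cart_prodD:
  assumes "((a, b), (a', b')) \<in> parcs (G \<square> H) ^^ n"
  shows "\<exists>i j. n = i + j \<and> (a, a') \<in> parcs G ^^ i \<and> (b, b') \<in> parcs H ^^ j"
  using assms
proof (induction n arbitrary: a' b')
  case 0
  then show ?case by simp
next
  case (Suc n)
  then obtain c d where cd: "((a, b), (c, d)) \<in> parcs (G \<square> H) ^^ n"
      "((c, d), (a', b')) \<in> parcs (G \<square> H)"
    by (auto simp: relcomp_unfold)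
  then obtain i j where ij: "n = i + j" "(a, c) \<in> parcs G ^^ i" "(b, d) \<in> parcs H ^^ j"
    using Suc.IH by blast
  from cd(2) consider "c = a'" "(d, b') \<in> parcs H" | "(c, a') \<in> parcs G" "d = b'"
    by auto
  then show ?case
  proof cases
    case 1
    then have "Suc n = i + Suc j" "(a, a') \<in> parcs G ^^ i" "(b, b') \<in> parcs H ^^ Suc j"
      using ij by auto
    then show ?thesis by blast
  next
    case 2
    then have "Suc n = Suc i + j" "(a, a') \<in> parcs G ^^ Suc i" "(b, b') \<in> parcs H ^^ j"
      using ij by auto
    then show ?thesis by blast
  qed
qed

text \<open>Upper bound for distances: walk in \<open>G\<close> at height \<open>b\<close> first,
  then in \<open>H\<close> above \<open>a'\<close>. Hence the vertex conditions on exactly these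
  two.\<close>

lemma relpow_cart_prod_add:
  assumes "(a, a') \<in> parcs G ^^ i" "(b, b') \<in> parcs H ^^ j" "a' \<in> pverts G" "b \<in> pverts H"
  shows "((a, b), (a', b')) \<in> parcs (G \<square> H) ^^ (i + j)"
  using relpow_cart_prod_fst[OF assms(1,4)] relpow_cart_prod_snd[OF assms(2,3)]
  by (auto simp: relpow_add)

lemma connected_cart_prod:
  assumes "pverts G \<times> pverts G \<subseteq> (parcs G)\<^sup>*" "pverts H \<times> pverts H \<subseteq> (parcs H)\<^sup>*"
  shows "pverts (G \<square> H) \<times> pverts (G \<square> H) \<subseteq> (parcs (G \<square> H))\<^sup>*"
proof safe
  fix a b a' b' assume "(a, b) \<in> pverts (G \<square> H)" "(a', b') \<in> pverts (G \<square> H)"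
  then have V: "a \<in> pverts G" "a' \<in> pverts G" "b \<in> pverts H" "b' \<in> pverts H" by auto
  then obtain i j where "(a, a') \<in> parcs G ^^ i" "(b, b') \<in> parcs H ^^ j"
    using assms rtrancl_imp_relpow by (metis mem_Sigma_iff subsetD)
  then show "((a, b), (a', b')) \<in> (parcs (G \<square> H))\<^sup>*"
    using relpow_cart_prod_add V relpow_imp_rtrancl by metis
qed

text \<open>Shortest walks of lengths \<open>i\<close> and \<open>j\<close> combine to one of length
  \<open>i + j\<close>, and the projections of any competing walk have lengths at least
  \<open>i\<close> and \<open>j\<close>.\<close>

lemma gdist_cart_prod:
  assumes "pair_graph G" "pair_graph H"
    and "pverts G \<times> pverts G \<subseteq> (parcs G)\<^sup>*" "pverts H \<times> pverts H \<subseteq> (parcs H)\<^sup>*"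
    and V: "a \<in> pverts G" "a' \<in> pverts G" "b \<in> pverts H" "b' \<in> pverts H"
  shows "gdist (G \<square> H) (a, b) (a', b') = gdist G a a' + gdist H b b'"
proof -
  obtain i where i: "gdist G a a' = ereal (real i)" "(a, a') \<in> parcs G ^^ i"
      "\<And>m. (a, a') \<in> parcs G ^^ m \<Longrightarrow> i \<le> m"
    using gdist_relpow_obtain[of G a a'] assms(1,3) V pair_graph_wf by blast
  obtain j where j: "gdist H b b' = ereal (real j)" "(b, b') \<in> parcs H ^^ j"
      "\<And>m. (b, b') \<in> parcs H ^^ m \<Longrightarrow> j \<le> m"
    using gdist_relpow_obtain[of H b b'] assms(2,4) V pair_graph_wf by blast
  have "gdist (G \<square> H) (a, b) (a', b') = ereal (real (i + j))"
  proof (rule gdist_eqI)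
    show "pair_wf_digraph (G \<square> H)"
      using assms by (intro pair_graph_wf pair_graph_cart_prod)
    show "((a, b), (a', b')) \<in> parcs (G \<square> H) ^^ (i + j)"
      using i j V by (intro relpow_cart_prod_add)
    show "i + j \<le> m" if "((a, b), (a', b')) \<in> parcs (G \<square> H) ^^ m" for m
      using relpow_cart_prodD[OF that] i(3) j(3) by (auto intro: add_mono)
  qed (use V in simp)
  then show ?thesis using i j by simp
qed

lemma gdist_finite:
  assumes "pair_graph X" "pverts X \<times> pverts X \<subseteq> (parcs X)\<^sup>*" "u \<in> pverts X" "v \<in> pverts X"
  shows "\<bar>gdist X u v\<bar> \<noteq> \<infinity>"
proof -
  have "(u, v) \<in> (parcs X)\<^sup>*" using assms by auto
  then show ?thesis
    using gdist_relpow_obtain[OF pair_graph_wf[OF assms(1)] assms(3)]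
    by (metis PInfty_neq_ereal(1) abs_ereal.simps(1))
qed

section \<open>The Mostar index of a product of two graphs\<close>

lemma n_closer_cart_prod:
  assumes "pair_graph G" "pair_graph H"
    and "pverts G \<times> pverts G \<subseteq> (parcs G)\<^sup>*" "pverts H \<times> pverts H \<subseteq> (parcs H)\<^sup>*"
    and "a \<in> pverts G" "a' \<in> pverts G" "b \<in> pverts H" "b' \<in> pverts H"
  shows n_closer_cart_prod_fst: "n_closer (G \<square> H) (a, b) (a', b) = n_closer G a a' * card (pverts H)"
    and n_closer_cart_prod_snd: "n_closer (G \<square> H) (a, b) (a, b') = card (pverts G) * n_closer H b b'"
proof -
  note dist = gdist_cart_prod[OF assms(1-4)]
  have fin: "\<bar>gdist G x y\<bar> \<noteq> \<infinity>" if "x \<in> pverts G" "y \<in> pverts G" for x y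
    using gdist_finite[OF assms(1,3) that] .
  have fin': "\<bar>gdist H x y\<bar> \<noteq> \<infinity>" if "x \<in> pverts H" "y \<in> pverts H" for x y
    using gdist_finite[OF assms(2,4) that] .
  \<comment> \<open>The common summand \<open>gdist H y b\<close> may be cancelled only because it
    is finite; the case split on \<open>ereal\<close> discards the infinite values and leaves real
    arithmetic.\<close>
  have "gdist (G \<square> H) (x, y) (a, b) < gdist (G \<square> H) (x, y) (a', b) \<longleftrightarrow> gdist G x a < gdist G x a'"
    if "x \<in> pverts G" "y \<in> pverts H" for x y
    using fin[of x a] fin[of x a'] fin'[of y b] that assms(5-8)
    by (cases rule: ereal3_cases[of "gdist G x a" "gdist G x a'" "gdist H y b"]) (simp_all add: dist)
  then have "{w \<in> pverts (G \<square> H). gdist (G \<square> H) w (a, b) < gdist (G \<square> H) w (a', b)} =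
      {x \<in> pverts G. gdist G x a < gdist G x a'} \<times> pverts H"
    by auto
  then show "n_closer (G \<square> H) (a, b) (a', b) = n_closer G a a' * card (pverts H)"
    unfolding n_closer_def by (simp add: card_cartesian_product)
  have "gdist (G \<square> H) (x, y) (a, b) < gdist (G \<square> H) (x, y) (a, b') \<longleftrightarrow> gdist H y b < gdist H y b'"
    if "x \<in> pverts G" "y \<in> pverts H" for x y
    using fin[of x a] fin'[of y b] fin'[of y b'] that assms(5-8)
    by (cases rule: ereal3_cases[of "gdist G x a" "gdist H y b" "gdist H y b'"]) (simp_all add: dist)
  then have "{w \<in> pverts (G \<square> H). gdist (G \<square> H) w (a, b) < gdist (G \<square> H) w (a, b')} =
      pverts G \<times> {y \<in> pverts H. gdist H y b < gdist H y b'}"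
    by auto
  then show "n_closer (G \<square> H) (a, b) (a, b') = card (pverts G) * n_closer H b b'"
    unfolding n_closer_def by (simp add: card_cartesian_product)
qed

lemma arc_imbalance_cart_prod_fst:
  assumes "pair_graph G" "pair_graph H"
    and "pverts G \<times> pverts G \<subseteq> (parcs G)\<^sup>*" "pverts H \<times> pverts H \<subseteq> (parcs H)\<^sup>*"
    and "(a, a') \<in> parcs G" "b \<in> pverts H"
  shows "arc_imbalance (G \<square> H) ((a, b), (a', b)) = int (card (pverts H)) * arc_imbalance G (a, a')"
proof -
  have "a \<in> pverts G" "a' \<in> pverts G"
    using assms(1,5) pair_graph_wf parcs_subset by blast+
  then show ?thesis
    using assms(6) by (simp add: arc_imbalance_def n_closer_cart_prod_fst[OF assms(1-4)]
        abs_mult flip: left_diff_distrib)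
qed

lemma arc_imbalance_cart_prod_snd:
  assumes "pair_graph G" "pair_graph H"
    and "pverts G \<times> pverts G \<subseteq> (parcs G)\<^sup>*" "pverts H \<times> pverts H \<subseteq> (parcs H)\<^sup>*"
    and "a \<in> pverts G" "(b, b') \<in> parcs H"
  shows "arc_imbalance (G \<square> H) ((a, b), (a, b')) = int (card (pverts G)) * arc_imbalance H (b, b')"
proof -
  have "b \<in> pverts H" "b' \<in> pverts H"
    using assms(2,6) pair_graph_wf parcs_subset by blast+
  then show ?thesis
    using assms(5) by (simp add: arc_imbalance_def n_closer_cart_prod_snd[OF assms(1-4)]
        abs_mult flip: right_diff_distrib)
qed

lemma Mostar_cart_prod:
  assumes G: "pair_graph G" and H: "pair_graph H"
    and "pverts G \<times> pverts G \<subseteq> (parcs G)\<^sup>*" "pverts H \<times> pverts H \<subseteq> (parcs H)\<^sup>*"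
  shows "Mostar (G \<square> H) =
    Mostar G * (int (card (pverts H)))\<^sup>2 + Mostar H * (int (card (pverts G)))\<^sup>2"
proof -
  \<comment> \<open>\<open>?f\<close> and \<open>?g\<close> parametrise the arcs that step in
    \<open>G\<close> and those that step in \<open>H\<close>, as copies of factor arcs.\<close>
  let ?f = "\<lambda>((a, a'), b). ((a, b), (a', b))" and ?g = "\<lambda>(a, (b, b')). ((a, b), (a, b'))"
  let ?A = "?f ` (parcs G \<times> pverts H)" and ?B = "?g ` (pverts G \<times> parcs H)"
  note fin = finite_pverts[OF G] finite_pverts[OF H] finite_parcs[OF G] finite_parcs[OF H]
  have "parcs (G \<square> H) = ?A \<union> ?B"
    by (force simp: cart_prod_def)
  \<comment> \<open>Arcs in \<open>?B\<close> keep the first coordinate, so a common arc would come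
    from a loop of \<open>G\<close>.\<close>
  moreover have "?A \<inter> ?B = {}"
    using irrefl_parcs[OF G] by (auto simp: irrefl_def)
  ultimately have "2 * Mostar (G \<square> H) =
      sum (arc_imbalance (G \<square> H)) ?A + sum (arc_imbalance (G \<square> H)) ?B"
    using fin by (simp add: double_Mostar pair_graph_cart_prod G H sum.union_disjoint)
  also have "sum (arc_imbalance (G \<square> H)) ?A =
      (\<Sum>e\<in>parcs G. \<Sum>b\<in>pverts H. int (card (pverts H)) * arc_imbalance G e)"
    unfolding sum.cartesian_product
    by (subst sum.reindex)
      (auto simp: inj_on_def arc_imbalance_cart_prod_fst[OF assms] intro!: sum.cong)
  \<comment> \<open>The inner sum is constant in \<open>b\<close>: its number of terms is the second
    factor \<open>card (pverts H)\<close>, whence the square.\<close>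
  also have "\<dots> = 2 * (Mostar G * (int (card (pverts H)))\<^sup>2)"
    by (simp add: double_Mostar[OF G] power2_eq_square flip: sum_distrib_left mult.assoc)
  also have "sum (arc_imbalance (G \<square> H)) ?B =
      (\<Sum>a\<in>pverts G. \<Sum>e\<in>parcs H. int (card (pverts G)) * arc_imbalance H e)"
    unfolding sum.cartesian_product
    by (subst sum.reindex)
      (auto simp: inj_on_def arc_imbalance_cart_prod_snd[OF assms] intro!: sum.cong)
  also have "\<dots> = 2 * (Mostar H * (int (card (pverts G)))\<^sup>2)"
    by (simp add: double_Mostar[OF H] power2_eq_square flip: sum_distrib_left mult.assoc)
  finally show ?thesis by simp
qed

section \<open>Invariance under injective relabelling\<close>

lemma pverts_relabel [simp]: "pverts (relabel f X) = f ` pverts X"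
  by (simp add: relabel_def)

lemma parcs_relabel [simp]: "parcs (relabel f X) = map_prod f f ` parcs X"
  by (simp add: relabel_def)

lemma pair_graph_relabel:
  assumes "inj f" "pair_graph X"
  shows "pair_graph (relabel f X)"
proof (rule pair_graphI)
  show "finite (pverts (relabel f X))"
    using assms by (simp add: finite_pverts)
  show "parcs (relabel f X) \<subseteq> pverts (relabel f X) \<times> pverts (relabel f X)"
    using parcs_subset[OF pair_graph_wf[OF assms(2)]] by auto
  show "sym (parcs (relabel f X))"
    using sym_parcs[OF assms(2)] by (force simp: sym_def image_iff)
  show "irrefl (parcs (relabel f X))"
    using irrefl_parcs[OF assms(2)] assms(1) by (auto simp: irrefl_def dest: injD)
qed

text \<open>The vertex before the last step is the source of an arc in the image, hence of the form
  \<open>f w\<close>; injectivity lets that arc be pulled back to one ending in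
  \<open>v\<close>.\<close>

lemma relpow_map_prod:
  assumes "inj f"
  shows "(f u, f v) \<in> (map_prod f f ` R) ^^ n \<longleftrightarrow> (u, v) \<in> R ^^ n"
proof (induction n arbitrary: v)
  case 0
  show ?case using assms by (simp add: inj_eq)
next
  case (Suc n)
  have "(f u, f v) \<in> (map_prod f f ` R) ^^ Suc n \<longleftrightarrow>
      (\<exists>w. (f u, f w) \<in> (map_prod f f ` R) ^^ n \<and> (w, v) \<in> R)"
    using assms by (auto simp: relcomp_unfold inj_eq)
  then show ?case by (auto simp: Suc.IH relcomp_unfold)
qed

lemma connected_relabel:
  assumes "inj f" "pverts X \<times> pverts X \<subseteq> (parcs X)\<^sup>*"
  shows "pverts (relabel f X) \<times> pverts (relabel f X) \<subseteq> (parcs (relabel f X))\<^sup>*"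
proof safe
  fix x y assume "x \<in> pverts (relabel f X)" "y \<in> pverts (relabel f X)"
  then obtain u v where uv: "x = f u" "y = f v" "u \<in> pverts X" "v \<in> pverts X"
    by auto
  then obtain n where "(u, v) \<in> parcs X ^^ n"
    using assms(2) rtrancl_imp_relpow by (metis mem_Sigma_iff subsetD)
  then have "(x, y) \<in> parcs (relabel f X) ^^ n"
    using uv by (simp add: relpow_map_prod[OF assms(1)])
  then show "(x, y) \<in> (parcs (relabel f X))\<^sup>*"
    by (rule relpow_imp_rtrancl)
qed

lemma gdist_relabel:
  assumes "inj f" "pair_graph X" "pverts X \<times> pverts X \<subseteq> (parcs X)\<^sup>*"
    and "u \<in> pverts X" "v \<in> pverts X"
  shows "gdist (relabel f X) (f u) (f v) = gdist X u v"
proof -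
  obtain n where n: "gdist X u v = ereal (real n)" "(u, v) \<in> parcs X ^^ n"
      "\<And>m. (u, v) \<in> parcs X ^^ m \<Longrightarrow> n \<le> m"
    using gdist_relpow_obtain[of X u v] assms pair_graph_wf by blast
  have "gdist (relabel f X) (f u) (f v) = ereal (real n)"
    using n assms by (intro gdist_eqI pair_graph_wf pair_graph_relabel) (auto simp: relpow_map_prod)
  then show ?thesis using n by simp
qed

lemma n_closer_relabel:
  assumes "inj f" "pair_graph X" "pverts X \<times> pverts X \<subseteq> (parcs X)\<^sup>*"
    and "u \<in> pverts X" "v \<in> pverts X"
  shows "n_closer (relabel f X) (f u) (f v) = n_closer X u v"
proof -
  have "{w \<in> pverts (relabel f X). gdist (relabel f X) w (f u) < gdist (relabel f X) w (f v)} =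
      f ` {w \<in> pverts X. gdist X w u < gdist X w v}"
    using gdist_relabel[OF assms(1-3)] assms(4,5) by auto
  then show ?thesis
    unfolding n_closer_def using assms(1) by (simp add: card_image inj_on_subset)
qed

text \<open>Allows the list encoding of the vertices of \<open>iter_prod\<close> to be dropped, so
  that the formula for two factors applies to the product of pairs.\<close>

lemma Mostar_relabel:
  assumes "inj f" "pair_graph X" "pverts X \<times> pverts X \<subseteq> (parcs X)\<^sup>*"
  shows "Mostar (relabel f X) = Mostar X"
proof -
  have "2 * Mostar (relabel f X) = sum (arc_imbalance (relabel f X)) (map_prod f f ` parcs X)"
    using assms by (simp add: double_Mostar pair_graph_relabel)
  also have "\<dots> = (\<Sum>e\<in>parcs X. arc_imbalance (relabel f X) (map_prod f f e))"
    using assms(1) by (subst sum.reindex) (auto simp: inj_on_def dest: injD)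
  also have "\<dots> = sum (arc_imbalance X) (parcs X)"
    using parcs_subset[OF pair_graph_wf[OF assms(2)]]
    by (intro sum.cong) (auto simp: arc_imbalance_def n_closer_relabel[OF assms])
  finally show ?thesis using double_Mostar[OF assms(2)] by simp
qed

section \<open>Iterated products\<close>

lemma inj_snoc: "inj (\<lambda>(xs, x). xs @ [x])"
  by (auto simp: inj_def)

text \<open>What the formula for two factors asks of the product accumulated so far: simplicity and
  connectedness as hypotheses, and the vertex count for its coefficient.\<close>

lemma iter_prod_invariants:
  assumes "\<And>m. m \<in> {1..k} \<Longrightarrow> pair_graph (G m)"
    and "\<And>m. m \<in> {1..k} \<Longrightarrow> pverts (G m) \<times> pverts (G m) \<subseteq> (parcs (G m))\<^sup>*"
  shows pair_graph_iter_prod: "pair_graph (iter_prod G k)"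
    and connected_iter_prod:
      "pverts (iter_prod G k) \<times> pverts (iter_prod G k) \<subseteq> (parcs (iter_prod G k))\<^sup>*"
    and card_pverts_iter_prod: "card (pverts (iter_prod G k)) = (\<Prod>j = 1..k. card (pverts (G j)))"
  using assms
proof (induction k)
  case 0
  {
    case 1
    show ?case by (rule pair_graphI) (auto simp: sym_def irrefl_def)
  next
    case 2
    show ?case by simp
  next
    case 3
    show ?case by simp
  }
next
  case (Suc k)
  {
    case 1
    then show ?case
      using Suc.IH(1) by (simp add: pair_graph_relabel pair_graph_cart_prod inj_snoc)
  next
    case 2
    then show ?case
      unfolding iter_prod.simps
      using Suc.IH(2) by (intro connected_relabel inj_snoc connected_cart_prod) auto
  next
    case 3
    then show ?case
      using Suc.IH(3)
      by (simp add: card_image[OF inj_on_subset[OF inj_snoc]] card_cartesian_product)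
  }
qed

text \<open>The induction starts from the one-vertex graph, whose index is the empty sum. Adding a
  factor multiplies every old summand by the new squared order and contributes one new
  summand.\<close>

lemma Mostar_iter_prod:
  assumes "\<And>m. m \<in> {1..k} \<Longrightarrow> pair_graph (G m)"
    and "\<And>m. m \<in> {1..k} \<Longrightarrow> pverts (G m) \<times> pverts (G m) \<subseteq> (parcs (G m))\<^sup>*"
  shows "Mostar (iter_prod G k) =
    (\<Sum>i = 1..k. Mostar (G i) * (\<Prod>j \<in> {1..k} - {i}. (int (card (pverts (G j))))\<^sup>2))"
  using assms
proof (induction k)
  case 0
  show ?case by (simp add: Mostar_def edge_set_def)
next
  case (Suc k)
  let ?P = "iter_prod G k" and ?s = "\<lambda>j. int (card (pverts (G j)))"
  have P: "pair_graph ?P" "pverts ?P \<times> pverts ?P \<subseteq> (parcs ?P)\<^sup>*"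
      "card (pverts ?P) = (\<Prod>j = 1..k. card (pverts (G j)))"
    using Suc.prems by (intro iter_prod_invariants; simp)+
  have Q: "pair_graph (G (Suc k))"
      "pverts (G (Suc k)) \<times> pverts (G (Suc k)) \<subseteq> (parcs (G (Suc k)))\<^sup>*"
    using Suc.prems by simp_all
  have IH: "Mostar ?P = (\<Sum>i = 1..k. Mostar (G i) * (\<Prod>j \<in> {1..k} - {i}. (?s j)\<^sup>2))"
    using Suc by simp
  have "Mostar (iter_prod G (Suc k)) = Mostar (?P \<square> G (Suc k))"
    using P Q by (simp add: Mostar_relabel inj_snoc pair_graph_cart_prod connected_cart_prod
        del: pverts_cart_prod)
  also have "\<dots> = Mostar ?P * (?s (Suc k))\<^sup>2 + Mostar (G (Suc k)) * (\<Prod>j = 1..k. (?s j)\<^sup>2)"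
    by (simp add: Mostar_cart_prod P(1,2) Q) (simp add: P(3) prod_power_distrib)
  also have "Mostar ?P * (?s (Suc k))\<^sup>2 =
      (\<Sum>i = 1..k. Mostar (G i) * (\<Prod>j \<in> {1..Suc k} - {i}. (?s j)\<^sup>2))"
    unfolding IH sum_distrib_right
  proof (rule sum.cong[OF refl])
    \<comment> \<open>Since \<open>i\<close> differs from \<open>Suc k\<close>, the new index
      survives the removal of \<open>i\<close> and supplies the extra square.\<close>
    fix i assume "i \<in> {1..k}"
    then have "{1..Suc k} - {i} = insert (Suc k) ({1..k} - {i})" by auto
    then show "Mostar (G i) * (\<Prod>j \<in> {1..k} - {i}. (?s j)\<^sup>2) * (?s (Suc k))\<^sup>2 =
        Mostar (G i) * (\<Prod>j \<in> {1..Suc k} - {i}. (?s j)\<^sup>2)"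
      by simp
  qed
  \<comment> \<open>Rewrites the coefficient of the new index as the summand for
    \<open>i = Suc k\<close>, which completes the sum.\<close>
  also have "(\<Prod>j = 1..k. (?s j)\<^sup>2) = (\<Prod>j \<in> {1..Suc k} - {Suc k}. (?s j)\<^sup>2)"
    by (rule prod.cong) auto
  finally show ?case by simp
qed

theorem theorem2:
  fixes G :: "nat \<Rightarrow> 'a pair_pre_digraph" and s :: "nat \<Rightarrow> nat" and k :: nat
  assumes "k \<ge> 2"
    and "\<And>m. m \<in> {1..k} \<Longrightarrow> pair_graph (G m)"
    and "\<And>m u v. m \<in> {1..k} \<Longrightarrow> u \<in> pverts (G m) \<Longrightarrow> v \<in> pverts (G m) \<Longrightarrow>
           u \<rightarrow>\<^sup>*\<^bsub>with_proj (G m)\<^esub> v"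
    and "\<And>m. m \<in> {1..k} \<Longrightarrow> card (pverts (G m)) = s m"
  shows "Mostar (iter_prod G k) =
    (\<Sum>i = 1..k. Mostar (G i) * (\<Prod>j \<in> {1..k} - {i}. (int (s j))\<^sup>2))"
proof -
  \<comment> \<open>Reachability in the digraph also confines walks to its vertices; only membership
    in the closure of the arc relation is carried over.\<close>
  have "pverts (G m) \<times> pverts (G m) \<subseteq> (parcs (G m))\<^sup>*" if "m \<in> {1..k}" for m
    using reachable_rtranclI[OF assms(3)[OF that]] by auto
  then have "Mostar (iter_prod G k) =
      (\<Sum>i = 1..k. Mostar (G i) * (\<Prod>j \<in> {1..k} - {i}. (int (card (pverts (G j))))\<^sup>2))"
    using assms(2) by (intro Mostar_iter_prod)
  also have "\<dots> = (\<Sum>i = 1..k. Mostar (G i) * (\<Prod>j \<in> {1..k} - {i}. (int (s j))\<^sup>2))"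
    using assms(4) by (intro sum.cong prod.cong arg_cong2[where f = "(*)"]) simp_all
  finally show ?thesis .
qed

end
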